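(* Let $\lambda_1,\dots,\lambda_D\in\mathbb{R}$ and let $f$ be the linear function $f(x)=\sum_{u=1}^D\lambda_u x_u$. Then $$\beta_0^f=\sum_{u=1}^D\lambda_u\bar\xi_u=f(\bar\xi),$$ and, for any $1\le j\le d$, $$\beta_j^f=\sum_{u\in J_j}\lambda_u(\xi_u-\bar\xi_u)=f\bigl(M_j\circ(\xi-\bar\xi)\bigr).$$
   Context: Setting (LIME for images). $\xi\in[0,1]^D$ is a fixed image with $D$ pixels. The superpixels $J_1,\dots,J_d$ are non-empty sets forming a partition of $\{1,\dots,D\}$. The replacement image $\bar\xi\in[0,1]^D$ is either constant equal to a given color, or the superpixel mean, $\bar\xi_u=\frac1{|J_k|}\sum_{v\in J_k}\xi_v$ for $u\in J_k$. Let $z=(z_1,\dots,z_d)$ be uniform on $\{0,1\}^d$; all expectations are with respect to $z$. The perturbed image $x\in[0,1]^D$ is $x_u=z_j\xi_u+(1-z_j)\bar\xi_u$ for $u\in J_j$. With bandwidth $\nu>0$, the weight is $\pi=\psi(S/d)$, where $S=\#\{j:z_j=0\}$ and $\psi(t)=\exp\left(\frac{-(1-\sqrt{1-t})^2}{2\nu^2}\right)$ for $t\in[0,1]$. $M_j\in\{0,1\}^D$ is the binary mask of $J_j$ (entry $1$ exactly on $J_j$) and $\circ$ is the termwise product; $f$ is viewed as a linear form on $\mathbb{R}^D$. Limit explanation. Write $\tilde z=(1,z_1,\dots,z_d)^\top\in\mathbb{R}^{d+1}$, $\Sigma=\mathbb{E}[\pi\tilde z\tilde z^\top]$ (an invertible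 matrix) and $\Gamma^f=\mathbb{E}[\pi f(x)\tilde z]$. Then $\beta^f=\Sigma^{-1}\Gamma^f\in\mathbb{R}^{d+1}$, with coordinates indexed by $0,1,\dots,d$ (coordinate $0$ is the intercept). It is the limit in probability, as the number of i.i.d. samples goes to infinity, of the weighted least-squares coefficients of $f(x)$ regressed on $\tilde z$ with weights $\pi$. *)

theory Defs
  imports "HOL-Probability.Probability"
begin

text \<open>
  Images with $D$ pixels are vectors of type \<open>real ^ 'p\<close> with $D$ = \<open>CARD('p)\<close>; the $d$ superpixels
  are the sets \<open>J j\<close> for \<open>j :: 'd\<close>, with $d$ = \<open>CARD('d)\<close>. Coefficient vectors in
  $R^{d+1}$ have type \<open>real ^ 'd option\<close>: \<open>None\<close> is the coordinate $0$ (the intercept) and \<open>Some j\<close>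
  the coordinate of superpixel \<open>j\<close>.
\<close>

definition is_image :: "real ^ 'p \<Rightarrow> bool" where
  "is_image \<xi> \<longleftrightarrow> (\<forall>u. 0 \<le> \<xi> $ u \<and> \<xi> $ u \<le> 1)"

definition superpixels :: "('d \<Rightarrow> 'p set) \<Rightarrow> bool" where
  "superpixels J \<longleftrightarrow> (\<forall>j. J j \<noteq> {}) \<and> disjoint_family J \<and> (\<Union>j. J j) = UNIV"

definition superpixel_of :: "('d \<Rightarrow> 'p set) \<Rightarrow> 'p \<Rightarrow> 'd" where
  "superpixel_of J u = (THE j. u \<in> J j)"

definition superpixel_mask :: "('d \<Rightarrow> 'p set) \<Rightarrow> 'd \<Rightarrow> real ^ 'p" where
  "superpixel_mask J j = (\<chi> u. if u \<in> J j then 1 else 0)"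

definition is_replacement :: "('d \<Rightarrow> 'p set) \<Rightarrow> real ^ 'p \<Rightarrow> real ^ 'p \<Rightarrow> bool" where
  "is_replacement J \<xi> \<xi>' \<longleftrightarrow> is_image \<xi>' \<and>
     ((\<exists>c. \<forall>u. \<xi>' $ u = c) \<or>
      (\<forall>k. \<forall>u\<in>J k. \<xi>' $ u = (\<Sum>v\<in>J k. \<xi> $ v) / real (card (J k))))"

definition perturbed ::
  "('d::finite \<Rightarrow> 'p set) \<Rightarrow> real ^ 'p \<Rightarrow> real ^ 'p \<Rightarrow> real ^ 'd \<Rightarrow> real ^ 'p" where
  "perturbed J \<xi> \<xi>' z =
     (\<chi> u. let j = superpixel_of J u in z $ j * \<xi> $ u + (1 - z $ j) * \<xi>' $ u)"

definition z_pmf :: "(real ^ 'd) pmf" where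
  "z_pmf = pmf_of_set {z. \<forall>j. z $ j \<in> {0, 1}}"

definition psi :: "real \<Rightarrow> real \<Rightarrow> real" where
  "psi \<nu> t = exp (- (1 - sqrt (1 - t))\<^sup>2 / (2 * \<nu>\<^sup>2))"

definition weight :: "real \<Rightarrow> real ^ 'd \<Rightarrow> real" where
  "weight \<nu> z = psi \<nu> (real (card {j. z $ j = 0}) / real CARD('d))"

definition ztilde :: "real ^ 'd \<Rightarrow> real ^ 'd option" where
  "ztilde z = (\<chi> i. case i of None \<Rightarrow> 1 | Some j \<Rightarrow> z $ j)"

definition Sigma_mat :: "real \<Rightarrow> real ^ ('d::finite) option ^ 'd option" where
  "Sigma_mat \<nu> = (\<chi> a b. measure_pmf.expectation (z_pmf :: (real ^ 'd) pmf)
      (\<lambda>z. weight \<nu> z * ztilde z $ a * ztilde z $ b))"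

definition Gamma_vec ::
  "('d::finite \<Rightarrow> 'p::finite set) \<Rightarrow> real \<Rightarrow> real ^ 'p \<Rightarrow> real ^ 'p \<Rightarrow> (real ^ 'p \<Rightarrow> real)
     \<Rightarrow> real ^ 'd option" where
  "Gamma_vec J \<nu> \<xi> \<xi>' f = (\<chi> a. measure_pmf.expectation z_pmf
      (\<lambda>z. weight \<nu> z * f (perturbed J \<xi> \<xi>' z) * ztilde z $ a))"

definition limit_expl ::
  "('d::finite \<Rightarrow> 'p::finite set) \<Rightarrow> real \<Rightarrow> real ^ 'p \<Rightarrow> real ^ 'p \<Rightarrow> (real ^ 'p \<Rightarrow> real)
     \<Rightarrow> real ^ 'd option" where
  "limit_expl J \<nu> \<xi> \<xi>' f = matrix_inv (Sigma_mat \<nu>) *v Gamma_vec J \<nu> \<xi> \<xi>' f"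

end

theory Submission
  imports Defs
begin

text \<open>
  On the support of \<open>z\<close> the response is exactly affine, \<open>f x = b \<bullet> ztilde z\<close>, where \<open>b\<close> is the
  claimed coefficient vector. Hence \<open>Gamma = Sigma b\<close>. The quadratic form
  \<open>c \<bullet> Sigma c = E[weight * (c \<bullet> ztilde)^2]\<close> vanishes only if \<open>c \<bullet> ztilde z = 0\<close> at every vertex
  of the cube, and evaluating at \<open>0\<close> and at the unit vectors gives \<open>c = 0\<close>. So \<open>Sigma\<close> is
  invertible and \<open>Sigma\<^sup>-\<^sup>1 Gamma = b\<close>.
\<close>

text \<open>A binary vector is the indicator of the set of coordinates where it equals 1, and a
  finite index type has only finitely many subsets.\<close>

lemma finite_binary_vectors: "finite {z :: real ^ 'd::finite. \<forall>j. z $ j \<in> {0, 1}}"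
proof (rule finite_subset)
  show "{z :: real ^ 'd. \<forall>j. z $ j \<in> {0, 1}} \<subseteq> range (\<lambda>A. \<chi> j. if j \<in> A then 1 else 0)"
  proof
    fix z :: "real ^ 'd"
    assume "z \<in> {z. \<forall>j. z $ j \<in> {0, 1}}"
    then have "z = (\<chi> j. if j \<in> {j. z $ j = 1} then 1 else 0)"
      by (auto simp: vec_eq_iff)
    then show "z \<in> range (\<lambda>A. \<chi> j. if j \<in> A then 1 else 0)" by blast
  qed
qed simp

lemma set_z_pmf: "set_pmf (z_pmf :: (real ^ 'd::finite) pmf) = {z. \<forall>j. z $ j \<in> {0, 1}}"
proof -
  have "(0 :: real ^ 'd) \<in> {z. \<forall>j. z $ j \<in> {0, 1}}" by simp
  then show ?thesis
    unfolding z_pmf_def using finite_binary_vectors by (intro set_pmf_of_set) blast+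
qed

text \<open>Finite support makes this automatic. As a simp rule it discharges the side conditions
  when expectations are exchanged with finite sums.\<close>

lemma integrable_z_pmf [simp]:
  fixes g :: "real ^ 'd::finite \<Rightarrow> real"
  shows "integrable (measure_pmf z_pmf) g"
  by (rule integrable_measure_pmf_finite) (use finite_binary_vectors in \<open>simp add: set_z_pmf\<close>)

lemma weight_pos: "weight \<nu> z > 0"
  by (simp add: weight_def psi_def)

lemma inner_ztilde: "c \<bullet> ztilde z = c $ None + (\<Sum>j\<in>UNIV. c $ Some j * z $ j)"
  by (simp add: inner_vec_def ztilde_def UNIV_option_conv sum.reindex)

text \<open>Linearity of expectation. The right-hand side has the shape of \<open>Gamma_vec\<close>
  with the response replaced by \<open>c \<bullet> ztilde z\<close>.\<close>

lemma Sigma_mat_mult: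
  "(Sigma_mat \<nu> *v c) $ a =
    measure_pmf.expectation z_pmf (\<lambda>z. weight \<nu> z * (c \<bullet> ztilde z) * ztilde z $ a)"
proof -
  have "(Sigma_mat \<nu> *v c) $ a =
      measure_pmf.expectation z_pmf
        (\<lambda>z. \<Sum>b\<in>UNIV. weight \<nu> z * ztilde z $ a * ztilde z $ b * c $ b)"
    by (simp add: matrix_vector_mult_def Sigma_mat_def)
  also have "(\<lambda>z. \<Sum>b\<in>UNIV. weight \<nu> z * ztilde z $ a * ztilde z $ b * c $ b) =
      (\<lambda>z. weight \<nu> z * (c \<bullet> ztilde z) * ztilde z $ a)"
    by (simp add: inner_vec_def sum_distrib_left sum_distrib_right mult_ac)
  finally show ?thesis .
qed

lemma inner_Sigma_mat:
  "c \<bullet> (Sigma_mat \<nu> *v c) =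
    measure_pmf.expectation z_pmf (\<lambda>z. weight \<nu> z * (c \<bullet> ztilde z)\<^sup>2)"
proof -
  have "c \<bullet> (Sigma_mat \<nu> *v c) =
      measure_pmf.expectation z_pmf
        (\<lambda>z. \<Sum>a\<in>UNIV. c $ a * (weight \<nu> z * (c \<bullet> ztilde z) * ztilde z $ a))"
    \<comment> \<open>The instance expands only the outer inner product, so
      \<open>c \<bullet> ztilde z\<close> stays intact as a factor under the expectation.\<close>
    by (simp add: inner_vec_def[of c "Sigma_mat \<nu> *v c"] Sigma_mat_mult)
  also have "(\<lambda>z. \<Sum>a\<in>UNIV. c $ a * (weight \<nu> z * (c \<bullet> ztilde z) * ztilde z $ a)) =
      (\<lambda>z. weight \<nu> z * (c \<bullet> ztilde z)\<^sup>2)"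
  proof
    fix z
    have "(\<Sum>a\<in>UNIV. c $ a * (weight \<nu> z * (c \<bullet> ztilde z) * ztilde z $ a)) =
        weight \<nu> z * (c \<bullet> ztilde z) * (\<Sum>a\<in>UNIV. c $ a * ztilde z $ a)"
      by (simp add: sum_distrib_left mult_ac)
    then show "(\<Sum>a\<in>UNIV. c $ a * (weight \<nu> z * (c \<bullet> ztilde z) * ztilde z $ a)) =
        weight \<nu> z * (c \<bullet> ztilde z)\<^sup>2"
      by (simp add: inner_vec_def power2_eq_square mult_ac)
  qed
  finally show ?thesis .
qed

lemma Sigma_mat_kernel:
  fixes c :: "real ^ 'd::finite option"
  assumes "Sigma_mat \<nu> *v c = 0"
  shows "c = 0"
proof -
  have "measure_pmf.expectation z_pmf (\<lambda>z. weight \<nu> z * (c \<bullet> ztilde z)\<^sup>2) = 0"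
    using assms inner_Sigma_mat[of c \<nu>] by simp
  then have "AE z in measure_pmf z_pmf. weight \<nu> z * (c \<bullet> ztilde z)\<^sup>2 = 0"
    by (subst (asm) integral_nonneg_eq_0_iff_AE) (simp_all add: weight_pos less_imp_le)
  \<comment> \<open>Every vertex of the cube has positive mass, so the almost sure statement holds
    at each vertex, and the positive weight cancels.\<close>
  then have zero: "c \<bullet> ztilde z = 0" if "\<forall>j. z $ j \<in> {0, 1}" for z
    using that weight_pos[of \<nu> z] by (auto simp: AE_measure_pmf_iff set_z_pmf)
  have None: "c $ None = 0"
    using zero[of 0] by (simp add: inner_ztilde)
  have "c $ Some j = 0" for j
    using zero[of "axis j 1"] None by (simp add: inner_ztilde axis_def if_distrib cong: if_cong)
  with None show ?thesis
    by (metis vec_eq_iff zero_index option.exhaust)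
qed

lemma matrix_inv_Sigma_mat: "matrix_inv (Sigma_mat \<nu>) ** Sigma_mat \<nu> = mat 1"
proof -
  have "invertible (Sigma_mat \<nu> :: real ^ 'd::finite option ^ 'd option)"
    \<comment> \<open>A trivial kernel gives a left inverse, which for a square matrix is enough for
      invertibility.\<close>
    by (simp add: invertible_left_inverse matrix_left_invertible_ker Sigma_mat_kernel)
  then show ?thesis
    \<comment> \<open>\<open>matrix_inv\<close> chooses some two-sided inverse; invertibility
      guarantees that the choice has a witness.\<close>
    unfolding invertible_def matrix_inv_def by (rule someI2_ex) blast
qed

text \<open>Weighted least squares recovers the coefficients of an exactly affine response. Only
  vertices of the cube matter, since the expectation in \<open>Gamma_vec\<close> sees only the
  support of \<open>z_pmf\<close>.\<close>

lemma limit_expl_eqI: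
  assumes "\<And>z. \<forall>j. z $ j \<in> {0, 1} \<Longrightarrow> f (perturbed J \<xi> \<xi>' z) = b \<bullet> ztilde z"
  shows "limit_expl J \<nu> \<xi> \<xi>' f = b"
proof -
  have "Gamma_vec J \<nu> \<xi> \<xi>' f = Sigma_mat \<nu> *v b"
    unfolding vec_eq_iff Gamma_vec_def Sigma_mat_mult
    by (auto intro!: integral_cong_AE simp: AE_measure_pmf_iff set_z_pmf assms)
  then show ?thesis
    by (simp add: limit_expl_def matrix_vector_mul_assoc matrix_inv_Sigma_mat)
qed

lemma superpixel_of_eq:
  assumes "superpixels J" "u \<in> J j"
  shows "superpixel_of J u = j"
  unfolding superpixel_of_def using assms
  by (auto simp: superpixels_def disjoint_family_on_def intro!: the_equality)

lemma sum_superpixels: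
  fixes J :: "'d::finite \<Rightarrow> 'p::finite set"
  assumes "superpixels J"
  shows "(\<Sum>u\<in>UNIV. g u) = (\<Sum>j\<in>UNIV. \<Sum>u\<in>J j. g u)"
proof -
  have "(\<Sum>u\<in>(\<Union>j. J j). g u) = (\<Sum>j\<in>UNIV. \<Sum>u\<in>J j. g u)"
    using assms by (intro sum.UNION_disjoint) (auto simp: superpixels_def disjoint_family_on_def)
  then show ?thesis using assms by (simp add: superpixels_def)
qed

text \<open>On \<open>J j\<close> a perturbed pixel is
  \<open>\<xi>' $ u + z $ j * (\<xi> $ u - \<xi>' $ u)\<close>. Grouping the pixels by superpixel
  therefore collects the coefficient of each \<open>z $ j\<close>.\<close>

lemma linear_perturbed:
  fixes J :: "'d::finite \<Rightarrow> 'p::finite set"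
  assumes "superpixels J"
  shows "(\<Sum>u\<in>UNIV. \<Lambda> $ u * perturbed J \<xi> \<xi>' z $ u) =
    (\<Sum>u\<in>UNIV. \<Lambda> $ u * \<xi>' $ u) +
    (\<Sum>j\<in>UNIV. (\<Sum>u\<in>J j. \<Lambda> $ u * (\<xi> $ u - \<xi>' $ u)) * z $ j)"
  unfolding sum_superpixels[OF assms] sum.distrib[symmetric] sum_distrib_right
  by (intro sum.cong refl)
    (simp add: perturbed_def Let_def superpixel_of_eq[OF assms] algebra_simps)

theorem proposition16:
  fixes J :: "'d::finite \<Rightarrow> 'p::finite set"
    and \<nu> :: real
    and \<xi> \<xi>' \<Lambda> :: "real ^ 'p"
    and f :: "real ^ 'p \<Rightarrow> real"
  assumes "superpixels J"
    and "\<nu> > 0"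
    and "is_image \<xi>"
    and "is_replacement J \<xi> \<xi>'"
    and f: "\<And>x. f x = (\<Sum>u\<in>UNIV. \<Lambda> $ u * x $ u)"
  shows "limit_expl J \<nu> \<xi> \<xi>' f $ None = (\<Sum>u\<in>UNIV. \<Lambda> $ u * \<xi>' $ u)
    \<and> (\<Sum>u\<in>UNIV. \<Lambda> $ u * \<xi>' $ u) = f \<xi>'
    \<and> (\<forall>j. limit_expl J \<nu> \<xi> \<xi>' f $ Some j = (\<Sum>u\<in>J j. \<Lambda> $ u * (\<xi> $ u - \<xi>' $ u))
           \<and> (\<Sum>u\<in>J j. \<Lambda> $ u * (\<xi> $ u - \<xi>' $ u)) = f (superpixel_mask J j * (\<xi> - \<xi>')))"
proof -
  define b :: "real ^ 'd option" where
    "b = (\<chi> i. case i of None \<Rightarrow> \<Sum>u\<in>UNIV. \<Lambda> $ u * \<xi>' $ u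
                | Some j \<Rightarrow> \<Sum>u\<in>J j. \<Lambda> $ u * (\<xi> $ u - \<xi>' $ u))"
  have "limit_expl J \<nu> \<xi> \<xi>' f = b"
    by (rule limit_expl_eqI) (simp add: f linear_perturbed[OF assms(1)] inner_ztilde b_def)
  \<comment> \<open>The product of vectors is termwise, so the mask annihilates every summand
    outside \<open>J j\<close>.\<close>
  moreover have "f (superpixel_mask J j * (\<xi> - \<xi>')) = (\<Sum>u\<in>J j. \<Lambda> $ u * (\<xi> $ u - \<xi>' $ u))" for j
    unfolding f superpixel_mask_def by (rule sum.mono_neutral_cong_right) auto
  ultimately show ?thesis
    by (simp add: b_def f)
qed

end
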